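(* Let $G$ be a finite group, let $p$ be the smallest prime dividing $|G|$, and let $m=[G:Z(G)]$. Then $$\operatorname{cp}(G)\ \ge\ \frac{(p+1)m-p}{m^2}.$$ Equality holds if and only if $[Z_G(a):Z(G)]=p$ for every $a\in G\setminus Z(G)$.
   Context: For a finite group $G$, the commuting probability of $G$ is $\operatorname{cp}(G)=\dfrac{|L(G)|}{|G|^2}$, where $L(G)=\{(x,y)\in G\times G: xy=yx\}$. $Z(G)$ denotes the center of $G$, and $Z_G(a)=\{y\in G: ay=ya\}$ denotes the centraliser of $a$ in $G$. *)

theory Defs
  imports Complex_Main "HOL-Computational_Algebra.Primes" "HOL-Algebra.Coset"
begin

definition group_center :: "('a, 'b) monoid_scheme \<Rightarrow> 'a set"
  where "group_center G =
    {z \<in> carrier G. \<forall>y \<in> carrier G. z \<otimes>\<^bsub>G\<^esub> y = y \<otimes>\<^bsub>G\<^esub> z}"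

definition centralizer :: "('a, 'b) monoid_scheme \<Rightarrow> 'a \<Rightarrow> 'a set"
  where "centralizer G a = {y \<in> carrier G. a \<otimes>\<^bsub>G\<^esub> y = y \<otimes>\<^bsub>G\<^esub> a}"

definition commuting_pairs :: "('a, 'b) monoid_scheme \<Rightarrow> ('a \<times> 'a) set"
  where "commuting_pairs G =
    {(x, y) \<in> carrier G \<times> carrier G. x \<otimes>\<^bsub>G\<^esub> y = y \<otimes>\<^bsub>G\<^esub> x}"

definition commuting_prob :: "('a, 'b) monoid_scheme \<Rightarrow> real"
  where "commuting_prob G = real (card (commuting_pairs G)) / (real (order G))^2"

(* For a subgroup K of G containing H, the index of H in K is
   subgroup_index (G\<lparr>carrier := K\<rparr>) H. *)
definition subgroup_index :: "('a, 'b) monoid_scheme \<Rightarrow> 'a set \<Rightarrow> nat"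
  where "subgroup_index G H = card (rcosets\<^bsub>G\<^esub> H)"

end

theory Submission
  imports Defs
begin

text \<open>
  Counting commuting pairs by their first entry gives $|L(G)| = \sum_a |Z_G(a)|$. Each centraliser
  contains the center, so $|Z_G(a)| = k_a |Z(G)|$ with $k_a = [Z_G(a) : Z(G)]$. A central element
  contributes $|G|$ to the sum. If $a$ is not central, then $a$ itself witnesses that
  $Z_G(a) \neq Z(G)$, so $k_a > 1$; and since $k_a$ divides $|G|$, every prime factor of $k_a$ is
  at least $p$, hence $k_a \ge p$.

  Replacing each $k_a$ by $p$ turns the sum into exactly the claimed bound, and the error can be
  written down: $\mathrm{cp}(G)$ minus the bound is a positive multiple of
  $\sum_{a \notin Z(G)} (k_a - p)$ (lemma \<open>commuting_prob_excess\<close>). All summands are nonnegative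
  (lemma \<open>centralizer_index_ge\<close>), so both the inequality and the case of equality can be read
  off from this one identity.
\<close>

context group
begin

lemma subgroup_centralizer:
  assumes "a \<in> carrier G"
  shows "subgroup (centralizer G a) G"
proof (rule subgroupI)
  show "centralizer G a \<noteq> {}"
    using assms by (auto simp: centralizer_def)
next
  fix x assume "x \<in> centralizer G a"
  then have x: "x \<in> carrier G" and comm: "a \<otimes> x = x \<otimes> a"
    by (auto simp: centralizer_def)
  have "x \<otimes> (a \<otimes> inv x) = (x \<otimes> a) \<otimes> inv x"
    using x assms by (simp add: m_assoc)
  also have "\<dots> = a"
    using x assms by (simp add: m_assoc flip: comm)
  finally have "inv x \<otimes> a = a \<otimes> inv x"
    using x assms by (metis inv_closed inv_solve_left m_closed)
  then show "inv x \<in> centralizer G a"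
    using x by (simp add: centralizer_def)
next
  fix x y assume "x \<in> centralizer G a" "y \<in> centralizer G a"
  then have x: "x \<in> carrier G" "a \<otimes> x = x \<otimes> a" and y: "y \<in> carrier G" "a \<otimes> y = y \<otimes> a"
    by (auto simp: centralizer_def)
  have "a \<otimes> (x \<otimes> y) = x \<otimes> y \<otimes> a"
    using assms x y by (metis m_assoc)
  then show "x \<otimes> y \<in> centralizer G a"
    using x y by (simp add: centralizer_def)
qed (auto simp: centralizer_def)

lemma group_center_eq_INT: "group_center G = (\<Inter>a \<in> carrier G. centralizer G a)"
  by (auto simp: group_center_def centralizer_def)

lemma subgroup_group_center: "subgroup (group_center G) G"
  unfolding group_center_eq_INT
  by (rule subgroups_Inter) (auto intro: subgroup_centralizer)

lemma centralizer_eq_carrier: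
  assumes "a \<in> group_center G"
  shows "centralizer G a = carrier G"
  using assms by (auto simp: group_center_def centralizer_def)

lemma order_eq_center_index:
  "order G = subgroup_index G (group_center G) * card (group_center G)"
  using lagrange[OF subgroup_group_center] by (simp add: subgroup_index_def)

lemma card_centralizer:
  assumes "a \<in> carrier G"
  shows "card (centralizer G a) =
    subgroup_index (G\<lparr>carrier := centralizer G a\<rparr>) (group_center G) * card (group_center G)"
proof -
  let ?C = "G\<lparr>carrier := centralizer G a\<rparr>"
  have "group ?C"
    by (rule subgroup.subgroup_is_group[OF subgroup_centralizer[OF assms] group_axioms])
  moreover have "subgroup (group_center G) ?C"
    using assms by (intro subgroup_incl subgroup_group_center subgroup_centralizer)
      (auto simp: group_center_eq_INT)
  ultimately show ?thesis
    using group.lagrange[of ?C "group_center G"] by (simp add: subgroup_index_def order_def)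
qed

lemma centralizer_index_dvd_order:
  assumes "a \<in> carrier G"
  shows "subgroup_index (G\<lparr>carrier := centralizer G a\<rparr>) (group_center G) dvd order G"
proof -
  have "card (centralizer G a) dvd order G"
    using lagrange[OF subgroup_centralizer[OF assms]] by (metis dvd_triv_right)
  then show ?thesis
    using card_centralizer[OF assms] by (metis dvd_mult_left)
qed

lemma centralizer_index_ge:
  assumes fin: "finite (carrier G)"
    and least: "\<And>q :: nat. prime q \<Longrightarrow> q dvd order G \<Longrightarrow> p \<le> q"
    and a: "a \<in> carrier G - group_center G"
  shows "p \<le> subgroup_index (G\<lparr>carrier := centralizer G a\<rparr>) (group_center G)" (is "p \<le> ?k")
proof -
  have k_dvd: "?k dvd order G"
    using a by (intro centralizer_index_dvd_order) auto
  moreover have "order G > 0"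
    using fin by (simp add: order_gt_0_iff_finite)
  ultimately have "?k > 0"
    by (auto intro: Nat.gr0I)
  have "group_center G \<subset> centralizer G a"
    using a by (auto simp: group_center_def centralizer_def)
  then have "card (group_center G) < card (centralizer G a)"
    using fin by (intro psubset_card_mono) (auto simp: centralizer_def)
  then have "?k \<noteq> 1"
    using a card_centralizer[of a] by auto
  then obtain q where q: "prime q" "q dvd ?k"
    using prime_factor_nat by blast
  then have "p \<le> q"
    using k_dvd least dvd_trans by blast
  also have "q \<le> ?k"
    using q \<open>?k > 0\<close> by (simp add: dvd_imp_le)
  finally show ?thesis .
qed

lemma card_commuting_pairs:
  assumes "finite (carrier G)"
  shows "card (commuting_pairs G) = (\<Sum>a \<in> carrier G. card (centralizer G a))"
proof -
  have "commuting_pairs G = Sigma (carrier G) (centralizer G)"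
    by (auto simp: commuting_pairs_def centralizer_def)
  then show ?thesis
    using assms by (simp add: card_SigmaI centralizer_def)
qed

text \<open>
  The bound is what the sum over the centralisers gives when every noncentral index is replaced
  by $p$. Keeping the error term exactly, and not only its sign, lets one identity serve both for
  the inequality and for the case of equality.
\<close>

lemma commuting_prob_excess:
  fixes p m :: nat
  assumes fin: "finite (carrier G)"
    and m: "m = subgroup_index G (group_center G)"
  shows "commuting_prob G = ((real p + 1) * real m - real p) / (real m)\<^sup>2
    + (\<Sum>a \<in> carrier G - group_center G.
        real (subgroup_index (G\<lparr>carrier := centralizer G a\<rparr>) (group_center G)) - real p)
      / (real (card (group_center G)) * (real m)\<^sup>2)"
proof -
  let ?Z = "group_center G"
  define k where "k a = subgroup_index (G\<lparr>carrier := centralizer G a\<rparr>) ?Z" for a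
  define z where "z = card ?Z"
  define e where "e = (\<Sum>a \<in> carrier G - ?Z. real (k a) - real p)"
  have Z_sub: "?Z \<subseteq> carrier G"
    by (auto simp: group_center_def)
  have order: "order G = m * z"
    using order_eq_center_index by (simp add: m z_def)
  have "order G > 0"
    using fin by (simp add: order_gt_0_iff_finite)
  then have pos: "m > 0" "z > 0"
    by (auto simp: order intro: Nat.gr0I)
  have "card (carrier G - ?Z) = m * z - z"
    using Z_sub fin order by (simp add: card_Diff_subset finite_subset order_def z_def)
  then have noncentral: "real (card (carrier G - ?Z)) = real m * real z - real z"
    using pos by (simp add: of_nat_diff)
  have "real (card (commuting_pairs G)) =
      (\<Sum>a \<in> carrier G - ?Z. real (card (centralizer G a))) + (\<Sum>a \<in> ?Z. real (card (centralizer G a)))"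
    by (simp add: card_commuting_pairs[OF fin] sum.subset_diff[OF Z_sub fin])
  also have "(\<Sum>a \<in> ?Z. real (card (centralizer G a))) = real z * (real m * real z)"
    using order by (simp add: centralizer_eq_carrier order_def z_def)
  also have "(\<Sum>a \<in> carrier G - ?Z. real (card (centralizer G a)))
      = (\<Sum>a \<in> carrier G - ?Z. (real (k a) - real p) * real z + real p * real z)"
    by (intro sum.cong) (auto simp: card_centralizer k_def z_def algebra_simps)
  also have "\<dots> = e * real z + (real m * real z - real z) * (real p * real z)"
    by (simp add: sum.distrib e_def noncentral flip: sum_distrib_right)
  finally have "real (card (commuting_pairs G)) =
      real z ^ 2 * ((real p + 1) * real m - real p) + real z * e"
    by (simp add: algebra_simps power2_eq_square)
  then have "commuting_prob G =
      ((real p + 1) * real m - real p) / (real m)\<^sup>2 + e / (real z * (real m)\<^sup>2)"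
    using pos by (simp add: commuting_prob_def order field_simps power2_eq_square)
  then show ?thesis
    by (simp add: e_def k_def z_def)
qed

end

theorem theorem19:
  fixes G :: "('a, 'b) monoid_scheme" and p m :: nat
  assumes "group G"
    and "finite (carrier G)"
    and "prime p" and "p dvd order G"
    and "\<And>q :: nat. prime q \<Longrightarrow> q dvd order G \<Longrightarrow> p \<le> q"
    and "m = subgroup_index G (group_center G)"
  shows "commuting_prob G \<ge> ((real p + 1) * real m - real p) / (real m)^2
    \<and> (commuting_prob G = ((real p + 1) * real m - real p) / (real m)^2
      \<longleftrightarrow> (\<forall>a \<in> carrier G - group_center G.
            subgroup_index (G\<lparr>carrier := centralizer G a\<rparr>) (group_center G) = p))"
proof -
  interpret group G by fact
  let ?Z = "group_center G"
  define k where "k a = subgroup_index (G\<lparr>carrier := centralizer G a\<rparr>) ?Z" for a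
  define c where "c = real (card ?Z) * (real m)\<^sup>2"
  have k_ge: "p \<le> k a" if "a \<in> carrier G - ?Z" for a
    unfolding k_def using assms(2,5) that by (rule centralizer_index_ge)
  have "order G > 0"
    using assms(2) by (simp add: order_gt_0_iff_finite)
  then have c: "c > 0"
    using order_eq_center_index assms(6) by (simp add: c_def)
  have cp: "commuting_prob G = ((real p + 1) * real m - real p) / (real m)\<^sup>2
      + (\<Sum>a \<in> carrier G - ?Z. real (k a) - real p) / c"
    unfolding k_def c_def using assms(2,6) by (rule commuting_prob_excess)
  have "(\<Sum>a \<in> carrier G - ?Z. real (k a) - real p) \<ge> 0"
    using k_ge by (intro sum_nonneg) simp
  moreover have "(\<Sum>a \<in> carrier G - ?Z. real (k a) - real p) = 0
      \<longleftrightarrow> (\<forall>a \<in> carrier G - ?Z. k a = p)"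
    using assms(2) k_ge by (subst sum_nonneg_eq_0_iff) auto
  ultimately show ?thesis
    using c by (simp add: cp flip: k_def)
qed

end
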